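(* Let $E(z)=a\exp(z)$ with $a\in\mathbb{C}\setminus\{0\}$. Assume that $0$ does not belong to the basin of an attracting cycle of $E$. Then $$\chi_-(E,0)=\liminf_{n\to\infty}\frac1n\log|DE^n(0)|\ge 0.$$
   Context: $DE^n$ denotes the complex derivative of the $n$-th iterate $E^n$. *)

theory Defs
  imports "HOL-Analysis.Analysis"
begin

definition in_attracting_basin :: "(complex \<Rightarrow> complex) \<Rightarrow> complex \<Rightarrow> bool" where
  "in_attracting_basin f z \<longleftrightarrow>
     (\<exists>z0 p. p > 0 \<and> (f ^^ p) z0 = z0 \<and> norm (deriv (f ^^ p) z0) < 1 \<and>
        (\<lambda>k. (f ^^ (k * p)) z) \<longlonglongrightarrow> z0)"

end

theory Submission
  imports Defs "HOL-Complex_Analysis.Complex_Analysis"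
begin

text \<open>
  Write \<open>E z = a exp z\<close> and \<open>z\<^sub>n = E^n(0)\<close>. If the lower exponent is below \<open>-\<epsilon>\<close>, then
  \<open>log |DE^n(0)| + \<epsilon> n\<close> has infinitely many record minima \<open>n\<close>, and at such \<open>n\<close>
  \<open>|DE^{n-k}(z\<^sub>k)| \<le> e^{-\<epsilon>(n-k)}\<close> for all \<open>k \<le> n\<close>. Let \<open>r\<close> be the distance from \<open>z\<^sub>n\<close> to the nearest
  earlier point \<open>z\<^sub>j\<close>. The ball \<open>B(z\<^sub>n, r)\<close> misses the singular values of \<open>E^n\<close>, so all inverse
  branches along the orbit exist on it, and by Koebe \<open>E^{n-k}\<close> maps a ball about \<open>z\<^sub>k\<close> of radius
  \<open>\<kappa> r e^{\<epsilon>(n-k)}\<close> univalently into \<open>B(z\<^sub>n, r)\<close>. For \<open>k = 0\<close> the \<open>2\<pi>i\<close>-periodicity of \<open>E\<close> forces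
  \<open>r = O(e^{-\<epsilon> n})\<close>. For \<open>k = j\<close>, if \<open>n - j\<close> is large, \<open>E^{n-j}\<close> contracts \<open>B(z\<^sub>j, 4r)\<close> into itself and
  \<open>0\<close> lies in the basin of an attracting cycle. Otherwise \<open>n - j\<close> stays bounded, and an accumulation
  point of the \<open>z\<^sub>n\<close> (which satisfy \<open>|z\<^sub>n| \<le> 1\<close>) is an attracting periodic point that captures the orbit.
\<close>


section \<open>A weak form of the Koebe quarter theorem\<close>

text \<open>The value at the centre is required to be taken only once, a weaker condition than
  univalence: it is what the square-root argument uses, and injective inverse branches satisfy
  it.\<close>

definition Koebe_constant :: "real \<Rightarrow> bool" where
  "Koebe_constant \<kappa> \<longleftrightarrow> \<kappa> > 0 \<and>
     (\<forall>g c r. g holomorphic_on ball c r \<longrightarrow> 0 < r \<longrightarrow> (\<forall>x\<in>ball c r. g x = g c \<longrightarrow> x = c) \<longrightarrow>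
        ball (g c) (\<kappa> * r * norm (deriv g c)) \<subseteq> g ` ball c r)"

text \<open>
  The optimal constant is 1/4, but any positive one suffices. If \<open>g\<close> omits \<open>y\<close>, the branch of
  \<open>- sqrt (1 - (g - g c) / (y - g c))\<close> with value \<open>-1\<close> at \<open>c\<close> omits 0 and 1, so Landau's theorem
  bounds its derivative at \<open>c\<close>.
\<close>

lemma weak_Koebe: "\<exists>\<kappa>. Koebe_constant \<kappa>"
proof -
  \<comment> \<open>Landau's radius depends only on \<open>h 0\<close>, so normalising the central
    value to -1 gives a radius \<open>R0\<close> common to all \<open>g\<close>.\<close>
  obtain R where Rpos: "\<And>z. 0 < R z"
    and R: "\<And>h. \<lbrakk>h holomorphic_on cball 0 (R (h 0));
              \<And>z. norm z \<le> R (h 0) \<Longrightarrow> h z \<noteq> 0 \<and> h z \<noteq> 1\<rbrakk> \<Longrightarrow> norm (deriv h 0) < 1"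
    using Landau_Picard by metis
  define R0 where "R0 = R (-1)"
  have R0: "R0 > 0" using Rpos by (simp add: R0_def)
  \<comment> \<open>The 4 combines the rescaling by \<open>r / (2 * R0)\<close> with the factor 1/2
    that the square root puts on the derivative.\<close>
  have "Koebe_constant (1 / (4 * R0))"
    unfolding Koebe_constant_def
  proof (intro conjI allI impI)
    show "0 < 1 / (4 * R0)" using R0 by simp
  next
    fix g :: "complex \<Rightarrow> complex" and c r
    assume holg: "g holomorphic_on ball c r" and r: "0 < r"
      and inj: "\<forall>x\<in>ball c r. g x = g c \<longrightarrow> x = c"
    show "ball (g c) (1 / (4 * R0) * r * norm (deriv g c)) \<subseteq> g ` ball c r"
    proof (rule subsetI, rule ccontr)
      fix y
      assume y: "y \<in> ball (g c) (1 / (4 * R0) * r * norm (deriv g c))"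
        and ny: "y \<notin> g ` ball c r"
      define w where "w = y - g c"
      have c: "c \<in> ball c r" using r by simp
      have w0: "w \<noteq> 0" using ny c by (auto simp: w_def)
      define q where "q = (\<lambda>x. 1 - (g x - g c) / w)"
      have q0: "q x \<noteq> 0" if "x \<in> ball c r" for x
        using that ny w0 by (auto simp: q_def w_def field_simps)
      have holq: "q holomorphic_on ball c r"
        unfolding q_def by (intro holomorphic_intros holg w0)
      obtain L where holL: "L holomorphic_on ball c r" and L: "\<And>x. x \<in> ball c r \<Longrightarrow> exp (L x) = q x"
        using holomorphic_logarithm_exists[OF _ _ holq q0 c] by auto
      define H where "H = (\<lambda>x. - exp ((L x - L c) / 2))"
      have expLc: "exp (L c) = 1" using L[OF c] by (simp add: q_def)
      have Hsq: "H x ^ 2 = q x" if "x \<in> ball c r" for x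
      proof -
        have "H x ^ 2 = exp (L x - L c)"
          by (simp add: H_def power2_eq_square flip: exp_add)
        then show ?thesis using expLc L[OF that] by (simp add: exp_diff)
      qed
      \<comment> \<open>\<open>H x = 1\<close> would force \<open>x = c\<close>, but there the
        chosen sign of the root gives -1.\<close>
      have H1: "H x \<noteq> 1" if x: "x \<in> ball c r" for x
      proof
        assume "H x = 1"
        then have "q x = 1" using Hsq[OF x] by simp
        then have "g x = g c" using w0 by (simp add: q_def)
        then have "x = c" using inj x by blast
        then show False using \<open>H x = 1\<close> by (simp add: H_def)
      qed
      have dg: "(g has_field_derivative deriv g c) (at c)"
        by (rule holomorphic_derivI[OF holg _ c]) simp
      have dL: "(L has_field_derivative deriv L c) (at c)"
        by (rule holomorphic_derivI[OF holL _ c]) simp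
      have "((\<lambda>x. exp (L x)) has_field_derivative deriv L c) (at c)"
        using DERIV_fun_exp[OF dL] expLc by simp
      then have "(q has_field_derivative deriv L c) (at c)"
        by (rule has_field_derivative_transform_within_open[of _ _ _ "ball c r"]) (use L c in auto)
      moreover have "(q has_field_derivative - (deriv g c / w)) (at c)"
        unfolding q_def using w0 by (auto intro!: derivative_eq_intros dg)
      ultimately have Lc: "deriv L c = - (deriv g c / w)" by (rule DERIV_unique)
      have dH: "(H has_field_derivative deriv g c / (2 * w)) (at c)"
        unfolding H_def using Lc by (auto intro!: derivative_eq_intros dL)
      define s where "s = r / (2 * R0)"
      have s: "s > 0" using r R0 by (simp add: s_def)
      define h where "h = (\<lambda>u. H (c + of_real s * u))"
      have in_ball: "c + of_real s * u \<in> ball c r" if "norm u \<le> R0" for u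
      proof -
        have "norm (of_real s * u) \<le> s * R0" using that s by (simp add: norm_mult)
        also have "\<dots> = r / 2" using R0 by (simp add: s_def)
        also have "\<dots> < r" using r by simp
        finally show ?thesis by (simp add: dist_norm)
      qed
      have holH: "H holomorphic_on ball c r"
        unfolding H_def by (intro holomorphic_intros holL) auto
      have h0: "h 0 = -1" by (simp add: h_def H_def)
      have holh: "h holomorphic_on cball 0 R0"
      proof -
        have "(H \<circ> (\<lambda>u. c + of_real s * u)) holomorphic_on cball 0 R0"
          by (rule holomorphic_on_compose_gen[OF _ holH])
            (use in_ball in \<open>auto intro!: holomorphic_intros\<close>)
        then show ?thesis by (simp add: h_def o_def)
      qed
      have "norm (deriv h 0) < 1"
      proof (rule R)
        show "h holomorphic_on cball 0 (R (h 0))" using holh by (simp add: h0 R0_def)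
        show "h z \<noteq> 0 \<and> h z \<noteq> 1" if "norm z \<le> R (h 0)" for z
          using H1[OF in_ball] that by (simp add: h0 R0_def h_def) (simp add: H_def)
      qed
      moreover have "(h has_field_derivative deriv g c / (2 * w) * of_real s) (at 0)"
        unfolding h_def
        by (rule DERIV_chain2[where f = H]) (use dH in \<open>auto intro!: derivative_eq_intros\<close>)
      ultimately have "norm (deriv g c / (2 * w) * of_real s) < 1" by (simp add: DERIV_imp_deriv)
      then have "norm (deriv g c) * s < 2 * norm w"
        using w0 s by (simp add: norm_mult norm_divide field_simps)
      moreover have "norm w < 1 / (4 * R0) * r * norm (deriv g c)"
        using y by (simp add: w_def dist_norm norm_minus_commute)
      ultimately show False using R0 by (simp add: s_def field_simps)
    qed
  qed
  then show ?thesis ..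
qed

section \<open>Convergence to attracting fixed points\<close>

text \<open>Only distances to \<open>w\<close> have to shrink, so this serves both a fixed point
  known through its derivative and one obtained from Banach's theorem.\<close>

lemma funpow_tendsto_fixpoint:
  fixes F :: "'a::metric_space \<Rightarrow> 'a"
  assumes "0 \<le> l" "l < 1" and x: "x \<in> S"
    and step: "\<And>y. y \<in> S \<Longrightarrow> F y \<in> S \<and> dist (F y) w \<le> l * dist y w"
  shows "(\<lambda>k. (F ^^ k) x) \<longlonglongrightarrow> w"
proof -
  have mem: "(F ^^ k) x \<in> S" for k by (induction k) (use x step in auto)
  have bound: "dist ((F ^^ k) x) w \<le> l ^ k * dist x w" for k
  proof (induction k)
    case (Suc k)
    have "dist ((F ^^ Suc k) x) w \<le> l * dist ((F ^^ k) x) w"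
      using step[OF mem[of k]] by simp
    also have "\<dots> \<le> l * (l ^ k * dist x w)"
      using Suc \<open>0 \<le> l\<close> by (rule mult_left_mono)
    finally show ?case by (simp add: mult.assoc)
  qed simp
  have "(\<lambda>k. l ^ k * dist x w) \<longlonglongrightarrow> 0"
    using LIMSEQ_realpow_zero[OF assms(1,2)] by (rule tendsto_mult_left_zero)
  then have "(\<lambda>k. dist ((F ^^ k) x) w) \<longlonglongrightarrow> 0"
    by (rule Lim_null_comparison[rotated]) (simp add: bound)
  then show ?thesis using tendsto_dist_iff by blast
qed

text \<open>Near \<open>w\<close> the difference quotient of \<open>F\<close> stays below some
  \<open>l < 1\<close>, so a small ball is mapped into itself with distances to \<open>w\<close>
  shrinking geometrically.\<close>

lemma attracting_fixpoint_neighbourhood: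
  fixes F :: "'a::real_normed_field \<Rightarrow> 'a"
  assumes D: "(F has_field_derivative D) (at w)" and "norm D < 1" and fp: "F w = w"
  obtains \<delta> where "\<delta> > 0" "\<And>x. x \<in> ball w \<delta> \<Longrightarrow> (\<lambda>k. (F ^^ k) x) \<longlonglongrightarrow> w"
proof -
  obtain l where l: "norm D < l" "l < 1" using \<open>norm D < 1\<close> dense by blast
  then have l0: "0 \<le> l" by (meson less_eq_real_def norm_ge_zero order_trans)
  have "((\<lambda>y. norm ((F y - F w) / (y - w))) \<longlongrightarrow> norm D) (at w)"
    using D by (intro tendsto_norm) (simp add: has_field_derivative_iff)
  then have "\<forall>\<^sub>F y in at w. norm ((F y - F w) / (y - w)) < l"
    using l order_tendstoD by blast
  then obtain d where d: "d > 0"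
    "\<And>y. \<lbrakk>y \<noteq> w; dist y w < d\<rbrakk> \<Longrightarrow> norm ((F y - F w) / (y - w)) < l"
    unfolding eventually_at by auto
  have lip: "dist (F y) w \<le> l * dist y w" if "y \<in> ball w d" for y
  proof (cases "y = w")
    case False
    have "dist y w < d" using that by (simp add: dist_commute)
    from d(2)[OF False this] False show ?thesis
      by (simp add: fp norm_divide dist_norm field_simps)
  qed (simp add: fp)
  have step: "F y \<in> ball w d \<and> dist (F y) w \<le> l * dist y w" if y: "y \<in> ball w d" for y
  proof -
    have "l * dist y w \<le> 1 * dist y w" using l by (intro mult_right_mono) auto
    then show ?thesis using lip[OF y] y by (auto simp: dist_commute)
  qed
  show thesis
    using that[OF d(1)] funpow_tendsto_fixpoint[OF l0 l(2) _ step] by blast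
qed

text \<open>Cauchy's estimate on discs of radius 3r/2 gives |F'| \<le> r / (3r/2) = 2/3 on
  \<open>cball c (2 * r)\<close>. The image lies within 2r of \<open>c\<close>, so this disc is
  invariant and Banach's theorem applies. The centre \<open>b\<close> is separate from
  \<open>c\<close> because it will be the orbit point that returns to distance \<open>r\<close> from
  \<open>c\<close>.\<close>

lemma holomorphic_contraction_fixpoint:
  assumes hol: "F holomorphic_on ball c (4 * r)" and r: "0 < r"
    and img: "F ` ball c (4 * r) \<subseteq> ball b r" and bc: "dist b c \<le> r"
  obtains w where "F w = w" "norm (deriv F w) < 1" "(\<lambda>k. (F ^^ k) c) \<longlonglongrightarrow> w"
proof -
  define S where "S = cball c (2 * r)"
  have S_sub: "S \<subseteq> ball c (4 * r)" using r by (auto simp: S_def)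
  have deriv_le: "norm (deriv F x) \<le> 2 / 3" if x: "x \<in> S" for x
  proof -
    have sub: "cball x (3 / 2 * r) \<subseteq> ball c (4 * r)"
    proof
      fix y assume "y \<in> cball x (3 / 2 * r)"
      then have "dist c y \<le> 2 * r + 3 / 2 * r"
        using x dist_triangle[of c y x] by (auto simp: S_def)
      then show "y \<in> ball c (4 * r)" using r by simp
    qed
    have holF: "F holomorphic_on cball x (3 / 2 * r)"
      using hol sub by (rule holomorphic_on_subset)
    have "norm ((deriv ^^ 1) F x) \<le> fact 1 * r / (3 / 2 * r) ^ 1"
    proof (rule Cauchy_higher_deriv_bound)
      show "F holomorphic_on ball x (3 / 2 * r)"
        using holF ball_subset_cball by (rule holomorphic_on_subset)
      show "continuous_on (cball x (3 / 2 * r)) F"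
        using holF by (rule holomorphic_on_imp_continuous_on)
      show "F y \<in> ball b r" if "y \<in> ball x (3 / 2 * r)" for y
        using that img sub ball_subset_cball by blast
    qed (use r in auto)
    then show ?thesis using r by simp
  qed
  have "norm (F x - F y) \<le> 2 / 3 * norm (x - y)" if "x \<in> S" "y \<in> S" for x y
  proof (rule field_differentiable_bound[of S F "deriv F"])
    show "(F has_field_derivative deriv F z) (at z within S)" if "z \<in> S" for z
      using holomorphic_derivI[OF hol] S_sub that by blast
  qed (use that deriv_le in \<open>auto simp: S_def\<close>)
  then have lip: "dist (F x) (F y) \<le> 2 / 3 * dist x y" if "x \<in> S" "y \<in> S" for x y
    using that by (simp add: dist_norm)
  have FS: "F x \<in> S" if "x \<in> S" for x
  proof -
    have "F x \<in> ball b r" using that S_sub img by blast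
    then have "dist b (F x) < r" by simp
    then have "dist c (F x) \<le> 2 * r" using bc dist_triangle[of c "F x" b] by (simp add: dist_commute)
    then show ?thesis by (simp add: S_def)
  qed
  have cS: "c \<in> S" using r by (simp add: S_def)
  have "\<exists>!x\<in>S. F x = x"
    by (rule Banach_fix[of S "2/3"]) (use cS FS lip in \<open>auto simp: S_def compact_imp_complete\<close>)
  then obtain w where w: "w \<in> S" "F w = w" by blast
  show thesis
  proof (rule that[OF w(2)])
    show "norm (deriv F w) < 1" using deriv_le[OF w(1)] by simp
    show "(\<lambda>k. (F ^^ k) c) \<longlonglongrightarrow> w"
      by (rule funpow_tendsto_fixpoint[of "2/3" _ S]) (use cS FS lip[of _ w] w in auto)
  qed
qed

section \<open>Record minima of a real sequence\<close>

text \<open>The first index at which \<open>T\<close> drops below its minimum over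
  \<open>{..N}\<close> is such a record.\<close>

lemma unbounded_below_record:
  fixes T :: "nat \<Rightarrow> real"
  assumes "\<And>B. \<exists>n. T n < B"
  obtains n where "n > N" "\<And>k. k < n \<Longrightarrow> T n \<le> T k"
proof -
  define B where "B = Min (T ` {..N})"
  define n where "n = (LEAST n. T n < B)"
  have n: "T n < B" unfolding n_def using assms[of B] LeastI_ex by metis
  have B: "B \<le> T k" if "k \<le> N" for k using that by (auto simp: B_def)
  show thesis
  proof (rule that)
    show "n > N" using n B by (meson not_le_imp_less order.strict_trans2 order_less_irrefl)
    show "T n \<le> T k" if "k < n" for k
      using not_less_Least[of k "\<lambda>n. T n < B"] that n unfolding n_def by simp
  qed
qed

section \<open>Iterates of the exponential map and their derivatives\<close>

definition expmap :: "complex \<Rightarrow> complex \<Rightarrow> complex" where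
  "expmap a = (\<lambda>z. a * exp z)"

lemma expmap_nonzero: "a \<noteq> 0 \<Longrightarrow> expmap a z \<noteq> 0"
  by (simp add: expmap_def)

text \<open>Since E' = E, the chain rule multiplies the orbit points after \<open>x\<close>; hence
  the shift \<open>Suc k\<close>.\<close>

lemma expmap_funpow_has_field_derivative:
  "(expmap a ^^ n has_field_derivative (\<Prod>k<n. (expmap a ^^ Suc k) x)) (at x)"
proof (induction n)
  case (Suc n)
  have "(expmap a has_field_derivative expmap a y) (at y)" for y
    unfolding expmap_def by (auto intro!: derivative_eq_intros)
  from DERIV_chain[OF this Suc] show ?case by (simp add: o_def mult.commute)
qed (simp add: id_def)

lemma deriv_expmap_funpow: "deriv (expmap a ^^ n) x = (\<Prod>k<n. (expmap a ^^ Suc k) x)"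
  using expmap_funpow_has_field_derivative by (rule DERIV_imp_deriv)

lemma expmap_funpow_has_deriv: "(expmap a ^^ n has_field_derivative deriv (expmap a ^^ n) x) (at x)"
  unfolding deriv_expmap_funpow by (rule expmap_funpow_has_field_derivative)

lemma deriv_expmap_funpow_nonzero: "a \<noteq> 0 \<Longrightarrow> deriv (expmap a ^^ n) x \<noteq> 0"
  by (simp add: deriv_expmap_funpow expmap_nonzero)

lemma expmap_funpow_holomorphic: "(expmap a ^^ n) holomorphic_on S"
  unfolding holomorphic_on_def field_differentiable_def
  using expmap_funpow_has_field_derivative has_field_derivative_at_within by blast

lemma isCont_expmap_funpow: "isCont (expmap a ^^ n) x"
  using expmap_funpow_has_field_derivative by (rule DERIV_isCont)

lemma isCont_deriv_expmap_funpow: "isCont (\<lambda>x. deriv (expmap a ^^ n) x) x"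
  unfolding deriv_expmap_funpow using isCont_expmap_funpow by (intro continuous_prod) blast

lemma deriv_expmap_funpow_add:
  "deriv (expmap a ^^ (m + n)) x = deriv (expmap a ^^ m) ((expmap a ^^ n) x) * deriv (expmap a ^^ n) x"
proof -
  have "((expmap a ^^ m) \<circ> (expmap a ^^ n) has_field_derivative
      deriv (expmap a ^^ m) ((expmap a ^^ n) x) * deriv (expmap a ^^ n) x) (at x)"
    by (intro DERIV_chain expmap_funpow_has_deriv)
  then show ?thesis by (simp add: funpow_add DERIV_imp_deriv)
qed

section \<open>Inverse branches and univalence\<close>

text \<open>The branch is pulled back one step at a time by a logarithm of \<open>g / a\<close>. A
  zero of \<open>g\<close> at \<open>x\<close> would give \<open>x\<close> = E^m(0), which the ball
  avoids.\<close>

lemma expmap_inverse_branch: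
  assumes a: "a \<noteq> 0" and r: "0 < r"
    and avoid: "\<And>k. k < n \<Longrightarrow> (expmap a ^^ k) 0 \<notin> ball ((expmap a ^^ n) 0) r"
    and "m \<le> n"
  shows "\<exists>g. g holomorphic_on ball ((expmap a ^^ n) 0) r \<and>
           g ((expmap a ^^ n) 0) = (expmap a ^^ (n - m)) 0 \<and>
           (\<forall>x\<in>ball ((expmap a ^^ n) 0) r. (expmap a ^^ m) (g x) = x)"
  using \<open>m \<le> n\<close>
proof (induction m)
  case 0
  show ?case by (rule exI[of _ "\<lambda>x. x"]) simp
next
  case (Suc m)
  define z where "z = (\<lambda>k. (expmap a ^^ k) 0)"
  define B where "B = ball (z n) r"
  have zn: "z n \<in> B" using r by (simp add: B_def)
  obtain g where g: "g holomorphic_on B" "g (z n) = z (n - m)"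
    "\<And>x. x \<in> B \<Longrightarrow> (expmap a ^^ m) (g x) = x"
    using Suc unfolding z_def B_def by auto
  have g0: "g x / a \<noteq> 0" if "x \<in> B" for x
  proof
    assume "g x / a = 0"
    then have "x = z m" using g(3)[OF that] a by (simp add: z_def)
    then show False using avoid[of m] that Suc.prems by (simp add: z_def B_def)
  qed
  have "(\<lambda>x. g x / a) holomorphic_on B" by (intro holomorphic_intros g a)
  then obtain L where L: "L holomorphic_on B" "\<And>x. x \<in> B \<Longrightarrow> exp (L x) = g x / a"
    using holomorphic_logarithm_exists[of B "\<lambda>x. g x / a" "z n"] zn g0 by (auto simp: B_def)
  \<comment> \<open>\<open>d\<close> is a period of \<open>exp\<close>; subtracting it selects the
    logarithm that follows the orbit of 0.\<close>
  define d where "d = L (z n) - z (n - Suc m)"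
  have "n - m = Suc (n - Suc m)" using Suc.prems by simp
  then have "z (n - m) = a * exp (z (n - Suc m))" by (simp add: z_def expmap_def)
  then have expd: "exp d = 1" using L(2)[OF zn] a g(2) by (simp add: d_def exp_diff)
  have step: "expmap a (L x - d) = g x" if "x \<in> B" for x
    using L(2)[OF that] expd a by (simp add: expmap_def exp_diff)
  have "(\<lambda>x. L x - d) holomorphic_on B" by (intro holomorphic_intros L)
  moreover have "(expmap a ^^ Suc m) (L x - d) = x" if "x \<in> B" for x
    using g(3)[OF that] step[OF that] by (simp add: funpow_Suc_right del: funpow.simps)
  moreover have "L (z n) - d = z (n - Suc m)" by (simp add: d_def)
  ultimately have "\<exists>g. g holomorphic_on B \<and> g (z n) = z (n - Suc m) \<and>
      (\<forall>x\<in>B. (expmap a ^^ Suc m) (g x) = x)" by blast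
  then show ?case unfolding z_def B_def .
qed

text \<open>The inverse branch \<open>g\<close> has derivative at \<open>c\<close> reciprocal to
  that of the iterate, so the Koebe bound puts \<open>U\<close> inside its image, where the iterate
  inverts \<open>g\<close>.\<close>

lemma expmap_univalent_ball:
  assumes \<kappa>: "Koebe_constant \<kappa>" and a: "a \<noteq> 0" and r: "0 < r" and j: "j \<le> n"
    and avoid: "\<And>k. k < n \<Longrightarrow> (expmap a ^^ k) 0 \<notin> ball ((expmap a ^^ n) 0) r"
  defines "U \<equiv> ball ((expmap a ^^ j) 0)
                   (\<kappa> * r / norm (deriv (expmap a ^^ (n - j)) ((expmap a ^^ j) 0)))"
  shows "(expmap a ^^ (n - j)) ` U \<subseteq> ball ((expmap a ^^ n) 0) r"
    and "inj_on (expmap a ^^ (n - j)) U"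
proof -
  define c where "c = (expmap a ^^ n) 0"
  define z where "z = (expmap a ^^ j) 0"
  define F where "F = expmap a ^^ (n - j)"
  obtain g where g: "g holomorphic_on ball c r" "g c = z" "\<And>x. x \<in> ball c r \<Longrightarrow> F (g x) = x"
    using expmap_inverse_branch[OF a r avoid, of "n - j"] j
    unfolding c_def z_def F_def by auto
  have c: "c \<in> ball c r" using r by simp
  have "(g has_field_derivative deriv g c) (at c)"
    by (rule holomorphic_derivI[OF g(1) _ c]) simp
  moreover have "(F has_field_derivative deriv F z) (at (g c))"
    unfolding F_def g(2) by (rule expmap_funpow_has_deriv)
  ultimately have "((\<lambda>x. F (g x)) has_field_derivative deriv F z * deriv g c) (at c)"
    by (intro DERIV_chain2[where f = F])
  then have "((\<lambda>x. x) has_field_derivative deriv F z * deriv g c) (at c)"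
    by (rule has_field_derivative_transform_within_open[of _ _ _ "ball c r"]) (use g c in auto)
  then have "deriv F z * deriv g c = 1" using DERIV_ident DERIV_unique by blast
  then have "norm (deriv F z) * norm (deriv g c) = 1" by (metis norm_mult norm_one)
  then have eq: "norm (deriv g c) = 1 / norm (deriv F z)"
    by (metis mult_zero_left nonzero_mult_div_cancel_left zero_neq_one)
  have "ball (g c) (\<kappa> * r * norm (deriv g c)) \<subseteq> g ` ball c r"
  proof -
    have "x = c" if "x \<in> ball c r" "g x = g c" for x
      using g(3)[OF that(1)] g(3)[OF c] that(2) by metis
    then show ?thesis using \<kappa> g(1) r unfolding Koebe_constant_def by simp
  qed
  then have sub: "ball z (\<kappa> * r / norm (deriv F z)) \<subseteq> g ` ball c r" by (simp add: eq g(2))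
  have "F ` g ` ball c r \<subseteq> ball c r" using g(3) by auto
  then show "(expmap a ^^ (n - j)) ` U \<subseteq> ball ((expmap a ^^ n) 0) r"
    using sub unfolding U_def c_def z_def F_def by blast
  have "inj_on F (g ` ball c r)" using g(3) by (intro inj_onI) auto
  then show "inj_on (expmap a ^^ (n - j)) U"
    using sub inj_on_subset unfolding U_def c_def z_def F_def by blast
qed

text \<open>A larger ball contains both i pi and -i pi, which the first application of E
  identifies.\<close>

lemma expmap_inj_on_ball_radius:
  assumes n: "n > 0" and inj: "inj_on (expmap a ^^ n) (ball 0 R)"
  shows "R \<le> pi"
proof (rule ccontr)
  assume "\<not> R \<le> pi"
  then have mem: "\<i> * pi \<in> ball 0 R" "- (\<i> * pi) \<in> ball 0 R" by (auto simp: norm_mult)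
  obtain m where "n = Suc m" using n gr0_implies_Suc by blast
  then have "(expmap a ^^ n) (\<i> * pi) = (expmap a ^^ n) (- (\<i> * pi))"
    by (simp add: funpow_Suc_right expmap_def exp_minus del: funpow.simps)
  from inj_onD[OF inj this mem] show False by simp
qed

section \<open>From convergence along the orbit to the basin of a cycle\<close>

text \<open>The basin is defined by iterates of 0 at multiples of the period, while
  \<open>lim\<close> starts at time \<open>j\<close>. Moving on by \<open>i\<close> steps aligns the
  times and replaces \<open>w\<close> by the point \<open>v\<close> of the same cycle.\<close>

lemma expmap_attracting_basin:
  assumes a: "a \<noteq> 0" and m: "m > 0" and fixp: "(expmap a ^^ m) w = w"
    and mult: "norm (deriv (expmap a ^^ m) w) < 1"
    and lim: "(\<lambda>k. ((expmap a ^^ m) ^^ k) ((expmap a ^^ j) 0)) \<longlonglongrightarrow> w"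
  shows "in_attracting_basin (expmap a) 0"
proof -
  let ?E = "expmap a"
  define i where "i = j * m - j"
  have ij: "i + j = j * m" using m by (simp add: i_def)
  define v where "v = (?E ^^ i) w"
  have comm: "(?E ^^ p) ((?E ^^ q) x) = (?E ^^ q) ((?E ^^ p) x)" for p q x
    by (simp add: add.commute flip: comp_apply[of "?E ^^ _"] funpow_add)
  have v: "(?E ^^ m) v = v" using comm fixp by (simp add: v_def)
  \<comment> \<open>Both sides are the derivative of E^(m+i) at \<open>w\<close>; cancelling the
    nonzero factor shows that the multiplier is constant along the cycle.\<close>
  have "deriv (?E ^^ m) v * deriv (?E ^^ i) w = deriv (?E ^^ i) w * deriv (?E ^^ m) w"
    using deriv_expmap_funpow_add[where a = a and m = m and n = i and x = w]
      deriv_expmap_funpow_add[where a = a and m = i and n = m and x = w]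
    unfolding fixp add.commute[of m i] v_def[symmetric] by auto
  then have dv: "deriv (?E ^^ m) v = deriv (?E ^^ m) w"
    using deriv_expmap_funpow_nonzero[OF a] by simp
  have "(\<lambda>k. (?E ^^ i) (((?E ^^ m) ^^ k) ((?E ^^ j) 0))) \<longlonglongrightarrow> v"
    unfolding v_def by (rule isCont_tendsto_compose[OF isCont_expmap_funpow lim])
  moreover have "(?E ^^ i) (((?E ^^ m) ^^ k) ((?E ^^ j) 0)) = (?E ^^ ((k + j) * m)) 0" for k
  proof -
    have "(?E ^^ i) (((?E ^^ m) ^^ k) ((?E ^^ j) 0)) = (?E ^^ (i + m * k + j)) 0"
      by (simp add: funpow_mult funpow_add)
    also have "i + m * k + j = (k + j) * m" using ij by (simp add: algebra_simps)
    finally show ?thesis .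
  qed
  ultimately have "(\<lambda>k. (?E ^^ ((k + j) * m)) 0) \<longlonglongrightarrow> v" by simp
  then have "(\<lambda>k. (?E ^^ (k * m)) 0) \<longlonglongrightarrow> v"
    by (rule LIMSEQ_offset[where k = j])
  then show ?thesis
    unfolding in_attracting_basin_def using m v dv mult
    by (intro exI[of _ v] exI[of _ m] conjI) simp_all
qed

section \<open>Exponential contraction and close returns\<close>

text \<open>At a record minimum \<open>n\<close> of \<open>T\<close>, the chain rule turns
  \<open>T n \<le> T k\<close> into contraction from time \<open>k\<close> to time
  \<open>n\<close>.\<close>

lemma negative_exponent_records:
  assumes a: "a \<noteq> 0"
    and neg: "\<not> 0 \<le> Liminf sequentially
                 (\<lambda>n. ereal (ln (norm (deriv (expmap a ^^ n) 0)) / real n))"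
  obtains \<epsilon> where "\<epsilon> > 0"
    "\<And>N. \<exists>n>N. \<forall>k\<le>n. norm (deriv (expmap a ^^ (n - k)) ((expmap a ^^ k) 0))
                    \<le> exp (- \<epsilon> * real (n - k))"
proof -
  define P where "P = (\<lambda>n. norm (deriv (expmap a ^^ n) 0))"
  have P: "P n > 0" for n using deriv_expmap_funpow_nonzero[OF a] by (simp add: P_def)
  obtain y :: ereal where y: "y < 0" "\<not> (\<forall>\<^sub>F n in sequentially. y < ereal (ln (P n) / real n))"
    using neg unfolding le_Liminf_iff P_def by blast
  obtain e :: real where e: "y < ereal e" "ereal e < 0"
    using ereal_dense2[OF y(1)] by blast
  \<comment> \<open>Half the decay rate: infinitely often \<open>ln (P n)\<close> is below
    \<open>- 2 * \<epsilon> * n\<close>, so \<open>T n\<close> is still below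
    \<open>- \<epsilon> * n\<close>.\<close>
  define \<epsilon> where "\<epsilon> = - e / 2"
  have \<epsilon>: "\<epsilon> > 0" using e(2) by (simp add: \<epsilon>_def)
  define T where "T = (\<lambda>n. ln (P n) + \<epsilon> * real n)"
  have unbdd: "\<exists>n. T n < B" for B
  proof -
    obtain N :: nat where N: "real N > - B / \<epsilon>" using reals_Archimedean2 by blast
    have "\<exists>n\<ge>Suc N. \<not> y < ereal (ln (P n) / real n)"
      using y(2) unfolding eventually_sequentially by blast
    then obtain n where n: "n \<ge> Suc N" "ereal (ln (P n) / real n) \<le> y" by (auto simp: not_less)
    have "ereal (ln (P n) / real n) < ereal e" using n(2) e(1) by (rule le_less_trans)
    then have "ln (P n) < e * real n" using n(1) by (simp add: field_simps)
    then have "T n < - \<epsilon> * real n" by (simp add: T_def \<epsilon>_def field_simps)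
    also have "\<dots> \<le> - \<epsilon> * real N" using n(1) \<epsilon> by simp
    also have "\<dots> < B" using N \<epsilon> by (simp add: field_simps)
    finally show ?thesis by blast
  qed
  show thesis
  proof (rule that[OF \<epsilon>])
    fix N
    obtain n where n: "n > N" "\<And>k. k < n \<Longrightarrow> T n \<le> T k"
      using unbounded_below_record[OF unbdd] by blast
    have "norm (deriv (expmap a ^^ (n - k)) ((expmap a ^^ k) 0)) \<le> exp (- \<epsilon> * real (n - k))"
      if "k \<le> n" for k
    proof -
      have "T n \<le> T k" using n(2) that by (cases "k = n") auto
      then have "ln (P n) \<le> - \<epsilon> * real (n - k) + ln (P k)"
        using that by (simp add: T_def of_nat_diff algebra_simps)
      then have "exp (ln (P n)) \<le> exp (- \<epsilon> * real (n - k) + ln (P k))" by (simp only: exp_le_cancel_iff)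
      then have "P n \<le> exp (- \<epsilon> * real (n - k)) * P k" using P by (simp only: exp_add exp_ln)
      moreover have "P n = norm (deriv (expmap a ^^ (n - k)) ((expmap a ^^ k) 0)) * P k"
        using deriv_expmap_funpow_add[where a = a and m = "n - k" and n = k and x = 0] that
        by (simp add: P_def norm_mult)
      ultimately show ?thesis using P[of k] by simp
    qed
    then show "\<exists>n>N. \<forall>k\<le>n. norm (deriv (expmap a ^^ (n - k)) ((expmap a ^^ k) 0))
                    \<le> exp (- \<epsilon> * real (n - k))"
      using n(1) by blast
  qed
qed

text \<open>The return time \<open>m\<close> is \<open>n - j\<close> for the nearest earlier point.
  Univalence at \<open>k = 0\<close> bounds the return distance; the image inclusion at
  \<open>k = j\<close> bounds \<open>m\<close>.\<close>

lemma expmap_close_return: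
  assumes \<kappa>: "Koebe_constant \<kappa>" and a: "a \<noteq> 0" and nb: "\<not> in_attracting_basin (expmap a) 0"
    and n: "n > 0" and \<epsilon>: "\<epsilon> > 0"
    and rec: "\<And>k. k \<le> n \<Longrightarrow> norm (deriv (expmap a ^^ (n - k)) ((expmap a ^^ k) 0))
                         \<le> exp (- \<epsilon> * real (n - k))"
  shows "\<exists>m. 0 < m \<and> m \<le> n \<and> \<kappa> * exp (\<epsilon> * real m) < 4 \<and>
           dist ((expmap a ^^ n) 0) ((expmap a ^^ (n - m)) 0) \<le> pi / \<kappa> * exp (- \<epsilon> * real n)"
proof -
  have \<kappa>0: "\<kappa> > 0" using \<kappa> by (simp add: Koebe_constant_def)
  define z where "z = (\<lambda>k. (expmap a ^^ k) 0)"
  define D where "D = (\<lambda>k. norm (deriv (expmap a ^^ (n - k)) (z k)))"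
  have D: "D k > 0" "k \<le> n \<Longrightarrow> D k \<le> exp (- \<epsilon> * real (n - k))" for k
    using deriv_expmap_funpow_nonzero[OF a] rec by (auto simp: D_def z_def)
  have zdiff: "(expmap a ^^ (n - k)) (z k) = z n" if "k \<le> n" for k
    using that by (simp add: z_def flip: funpow_add comp_apply[where f = "expmap a ^^ (n - k)"])
  define r where "r = Min ((\<lambda>k. dist (z n) (z k)) ` {..<n})"
  have "r \<in> (\<lambda>k. dist (z n) (z k)) ` {..<n}"
    unfolding r_def using n by (intro Min_in) auto
  then obtain j where j: "j < n" "r = dist (z n) (z j)" by auto
  have r_le: "r \<le> dist (z n) (z k)" if "k < n" for k
    unfolding r_def using that by (intro Min_le) auto
  have Dj: "D j < 1"
  proof -
    have "D j \<le> exp (- \<epsilon> * real (n - j))" using D(2) j(1) by simp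
    also have "\<dots> < 1" using \<epsilon> j(1) by simp
    finally show ?thesis .
  qed
  \<comment> \<open>If \<open>r\<close> were 0, \<open>z j\<close> would be periodic with multiplier
    of modulus \<open>D j < 1\<close>.\<close>
  have r: "r > 0"
  proof (rule ccontr)
    assume "\<not> r > 0"
    then have "z n = z j" using j(2) by simp
    then have fixp: "(expmap a ^^ (n - j)) (z j) = z j" using zdiff[of j] j(1) by simp
    then have "((expmap a ^^ (n - j)) ^^ k) (z j) = z j" for k by (induction k) auto
    then have "(\<lambda>k. ((expmap a ^^ (n - j)) ^^ k) (z j)) \<longlonglongrightarrow> z j" by simp
    then have "in_attracting_basin (expmap a) 0"
      using expmap_attracting_basin[OF a _ fixp] Dj j(1) unfolding D_def z_def by simp
    then show False using nb by simp
  qed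
  have avoid: "(expmap a ^^ k) 0 \<notin> ball ((expmap a ^^ n) 0) r" if "k < n" for k
    using r_le[OF that] by (simp add: z_def)
  have U: "(expmap a ^^ (n - k)) ` ball (z k) (\<kappa> * r / D k) \<subseteq> ball (z n) r"
    "inj_on (expmap a ^^ (n - k)) (ball (z k) (\<kappa> * r / D k))" if "k \<le> n" for k
    using expmap_univalent_ball[OF \<kappa> a r that avoid] unfolding D_def z_def by auto
  have "\<kappa> * r / D 0 \<le> pi"
    using expmap_inj_on_ball_radius[OF n, of a] U(2)[of 0] by (simp add: z_def)
  then have "r \<le> pi / \<kappa> * D 0" using D(1)[of 0] \<kappa>0 by (simp add: field_simps)
  also have "\<dots> \<le> pi / \<kappa> * exp (- \<epsilon> * real n)" using D(2)[of 0] \<kappa>0 by (intro mult_left_mono) auto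
  finally have r_small: "r \<le> pi / \<kappa> * exp (- \<epsilon> * real n)" .
  have "\<kappa> * exp (\<epsilon> * real (n - j)) < 4"
  proof (rule ccontr)
    \<comment> \<open>A long return would make the univalent ball at \<open>z j\<close> have radius
      at least 4r, and the contraction argument would give an attracting cycle.\<close>
    assume "\<not> ?thesis"
    then have "4 * r \<le> \<kappa> * exp (\<epsilon> * real (n - j)) * r" using r by (intro mult_right_mono) auto
    also have "\<dots> = \<kappa> * r / exp (- \<epsilon> * real (n - j))" by (simp add: exp_minus field_simps)
    also have "\<dots> \<le> \<kappa> * r / D j"
      using D(1)[of j] D(2)[of j] j(1) \<kappa>0 r by (intro divide_left_mono) auto
    finally have "ball (z j) (4 * r) \<subseteq> ball (z j) (\<kappa> * r / D j)" by (rule subset_ball)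
    then have img: "(expmap a ^^ (n - j)) ` ball (z j) (4 * r) \<subseteq> ball (z n) r"
      using U(1)[of j] j(1) by fastforce
    obtain w where "(expmap a ^^ (n - j)) w = w" "norm (deriv (expmap a ^^ (n - j)) w) < 1"
      "(\<lambda>k. ((expmap a ^^ (n - j)) ^^ k) (z j)) \<longlonglongrightarrow> w"
      using holomorphic_contraction_fixpoint[OF expmap_funpow_holomorphic r img] j(2) by auto
    then have "in_attracting_basin (expmap a) 0"
      using expmap_attracting_basin[OF a, of "n - j" w j] j(1) unfolding z_def by simp
    then show False using nb by simp
  qed
  moreover have "dist (z n) (z (n - (n - j))) \<le> pi / \<kappa> * exp (- \<epsilon> * real n)"
    using r_small j by simp
  ultimately show ?thesis
    unfolding z_def using j(1) by (intro exI[of _ "n - j"]) simp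
qed

text \<open>The bound \<open>B\<close> provides an accumulation point \<open>w\<close>. Returns
  after \<open>m\<close> steps at vanishing distance make \<open>w\<close> a fixed point of E^m, and
  the uniform \<open>l < 1\<close> keeps its multiplier strictly attracting in the limit. One orbit
  point near \<open>w\<close> is then captured.\<close>

lemma expmap_recurrent_contraction_basin:
  assumes a: "a \<noteq> 0" and m: "m > 0" and l: "l < 1" and d: "d \<longlonglongrightarrow> 0"
    and freq: "\<exists>\<^sub>F n in sequentially. m \<le> n \<and> norm ((expmap a ^^ n) 0) \<le> B \<and>
        dist ((expmap a ^^ n) 0) ((expmap a ^^ (n - m)) 0) \<le> d n \<and>
        norm (deriv (expmap a ^^ m) ((expmap a ^^ (n - m)) 0)) \<le> l"
  shows "in_attracting_basin (expmap a) 0"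
proof -
  define z where "z = (\<lambda>k. (expmap a ^^ k) 0)"
  define Q where "Q = (\<lambda>n. m \<le> n \<and> norm (z n) \<le> B \<and> dist (z n) (z (n - m)) \<le> d n \<and>
        norm (deriv (expmap a ^^ m) (z (n - m))) \<le> l)"
  have "infinite {n. Q n}"
    using freq unfolding Q_def z_def frequently_cofinite[symmetric] cofinite_eq_sequentially .
  then obtain \<nu> :: "nat \<Rightarrow> nat" where \<nu>: "strict_mono \<nu>" "\<And>i. Q (\<nu> i)"
    using infinite_enumerate by blast
  have "\<forall>i. (z \<circ> \<nu>) i \<in> cball 0 B" using \<nu>(2) by (simp add: Q_def)
  then obtain w s where s: "strict_mono s" "((z \<circ> \<nu>) \<circ> s) \<longlonglongrightarrow> w"
    using compact_cball[of "0::complex" B] unfolding compact_def by blast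
  define t where "t = \<nu> \<circ> s"
  have t: "strict_mono t" unfolding t_def using \<nu>(1) s(1) by (rule strict_mono_o)
  have Q: "m \<le> t i" "dist (z (t i)) (z (t i - m)) \<le> d (t i)"
    "norm (deriv (expmap a ^^ m) (z (t i - m))) \<le> l" for i
    using \<nu>(2)[of "s i"] by (simp_all add: Q_def t_def)
  have lim: "(\<lambda>i. z (t i)) \<longlonglongrightarrow> w" using s(2) by (simp add: t_def o_def)
  have "(\<lambda>i. d (t i)) \<longlonglongrightarrow> 0" using LIMSEQ_subseq_LIMSEQ[OF d t] by (simp add: o_def)
  then have "(\<lambda>i. dist (z (t i)) (z (t i - m))) \<longlonglongrightarrow> 0"
    by (rule Lim_null_comparison[rotated]) (simp add: Q(2))
  then have "(\<lambda>i. z (t i) - z (t i - m)) \<longlonglongrightarrow> 0"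
    by (simp add: dist_norm tendsto_norm_zero_iff)
  from tendsto_diff[OF lim this] have lim': "(\<lambda>i. z (t i - m)) \<longlonglongrightarrow> w" by simp
  have "(expmap a ^^ m) (z (t i - m)) = z (t i)" for i
    using Q(1)[of i] by (simp add: z_def flip: funpow_add comp_apply[where f = "expmap a ^^ m"])
  then have "(\<lambda>i. z (t i)) \<longlonglongrightarrow> (expmap a ^^ m) w"
    using isCont_tendsto_compose[OF isCont_expmap_funpow lim', of m a] by simp
  then have fixp: "(expmap a ^^ m) w = w" using lim LIMSEQ_unique by blast
  have "(\<lambda>i. norm (deriv (expmap a ^^ m) (z (t i - m)))) \<longlonglongrightarrow> norm (deriv (expmap a ^^ m) w)"
    by (intro tendsto_norm isCont_tendsto_compose[OF isCont_deriv_expmap_funpow lim'])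
  then have "norm (deriv (expmap a ^^ m) w) \<le> l"
    by (rule LIMSEQ_le_const2) (use Q(3) in auto)
  then have mult: "norm (deriv (expmap a ^^ m) w) < 1" using l by simp
  obtain \<delta> where \<delta>: "\<delta> > 0"
    "\<And>x. x \<in> ball w \<delta> \<Longrightarrow> (\<lambda>k. ((expmap a ^^ m) ^^ k) x) \<longlonglongrightarrow> w"
    using attracting_fixpoint_neighbourhood[OF expmap_funpow_has_deriv mult fixp] by blast
  obtain i where "dist (z (t i)) w < \<delta>"
    using tendstoD[OF lim \<delta>(1)] eventually_sequentially by auto
  then have "(\<lambda>k. ((expmap a ^^ m) ^^ k) (z (t i))) \<longlonglongrightarrow> w"
    using \<delta>(2) by (simp add: dist_commute)
  then show ?thesis
    using expmap_attracting_basin[OF a m fixp mult] unfolding z_def by blast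
qed

section \<open>Nonnegativity of the lower exponent\<close>

theorem theorem1p2:
  fixes a :: complex
  assumes "a \<noteq> 0"
    and "\<not> in_attracting_basin (\<lambda>z. a * exp z) 0"
  shows "Liminf sequentially
           (\<lambda>n. ereal (ln (norm (deriv ((\<lambda>z. a * exp z) ^^ n) 0)) / real n)) \<ge> 0"
proof (rule ccontr)
  assume "\<not> ?thesis"
  then have neg: "\<not> 0 \<le> Liminf sequentially
      (\<lambda>n. ereal (ln (norm (deriv (expmap a ^^ n) 0)) / real n))"
    by (simp add: expmap_def)
  have nb: "\<not> in_attracting_basin (expmap a) 0" using assms(2) by (simp add: expmap_def)
  obtain \<epsilon> where \<epsilon>: "\<epsilon> > 0"
    and records: "\<And>N. \<exists>n>N. \<forall>k\<le>n. norm (deriv (expmap a ^^ (n - k)) ((expmap a ^^ k) 0))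
                    \<le> exp (- \<epsilon> * real (n - k))"
    using negative_exponent_records[OF assms(1) neg] by blast
  obtain \<kappa> where Koebe: "Koebe_constant \<kappa>" using weak_Koebe by blast
  then have \<kappa>: "\<kappa> > 0" by (simp add: Koebe_constant_def)
  \<comment> \<open>By x < exp x, \<open>\<kappa> * exp (\<epsilon> * m) < 4\<close> forces
    \<open>\<epsilon> * m < 4 / \<kappa>\<close>, so \<open>M\<close> bounds all return
    times.\<close>
  obtain M :: nat where M: "4 / \<kappa> / \<epsilon> < real M" using reals_Archimedean2 by blast
  have small: "m \<le> M" if "\<kappa> * exp (\<epsilon> * real m) < 4" for m
  proof -
    have "\<epsilon> * real m < exp (\<epsilon> * real m)" using exp_ge_add_one_self[of "\<epsilon> * real m"] by linarith
    also have "\<dots> < 4 / \<kappa>" using that \<kappa> by (simp add: field_simps)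
    also have "\<dots> < \<epsilon> * real M" using M \<epsilon> \<kappa> by (simp add: field_simps)
    finally show ?thesis using \<epsilon> by simp
  qed
  define Q where "Q = (\<lambda>n m. m \<le> n \<and> norm ((expmap a ^^ n) 0) \<le> 1 \<and>
      dist ((expmap a ^^ n) 0) ((expmap a ^^ (n - m)) 0) \<le> pi / \<kappa> * exp (- \<epsilon> * real n) \<and>
      norm (deriv (expmap a ^^ m) ((expmap a ^^ (n - m)) 0)) \<le> exp (- \<epsilon>))"
  have "\<exists>n>N. \<exists>m\<in>{1..M}. Q n m" for N
  proof -
    obtain n where n: "n > N" and rec: "\<And>k. k \<le> n \<Longrightarrow>
        norm (deriv (expmap a ^^ (n - k)) ((expmap a ^^ k) 0)) \<le> exp (- \<epsilon> * real (n - k))"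
      using records by blast
    have "n > 0" using n by simp
    obtain m where m: "0 < m" "m \<le> n" "\<kappa> * exp (\<epsilon> * real m) < 4"
      "dist ((expmap a ^^ n) 0) ((expmap a ^^ (n - m)) 0) \<le> pi / \<kappa> * exp (- \<epsilon> * real n)"
      using expmap_close_return[OF Koebe assms(1) nb \<open>n > 0\<close> \<epsilon> rec] by blast
    have "norm (deriv (expmap a ^^ m) ((expmap a ^^ (n - m)) 0)) \<le> exp (- \<epsilon> * real m)"
      using rec[of "n - m"] m(2) by simp
    \<comment> \<open>As \<open>m\<close> is at least 1, this bound is uniform in \<open>m\<close>
      and \<open>n\<close>.\<close>
    also have "\<dots> \<le> exp (- \<epsilon>)" using \<epsilon> m(1) by simp
    finally have contr: "norm (deriv (expmap a ^^ m) ((expmap a ^^ (n - m)) 0)) \<le> exp (- \<epsilon>)" .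
    obtain p where p: "n = Suc p" using \<open>n > 0\<close> gr0_implies_Suc by blast
    \<comment> \<open>Because E' = E, |z_n| is the derivative of the last step, so the record
      property at \<open>k = n - 1\<close> bounds it by 1.\<close>
    have "norm ((expmap a ^^ n) 0) = norm (deriv (expmap a ^^ (n - p)) ((expmap a ^^ p) 0))"
      by (simp add: p deriv_expmap_funpow del: funpow.simps) simp
    also have "\<dots> \<le> exp (- \<epsilon> * real (n - p))" using rec[of p] p by simp
    also have "\<dots> \<le> 1" using \<epsilon> by simp
    finally have "Q n m" using m contr by (simp add: Q_def)
    moreover have "m \<in> {1..M}" using m(1) small[OF m(3)] by simp
    ultimately show ?thesis using n by blast
  qed
  then have "\<exists>\<^sub>F n in sequentially. \<exists>m\<in>{1..M}. Q n m"
    unfolding frequently_sequentially using less_imp_le by blast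
  \<comment> \<open>Pigeonhole: one of the finitely many return times occurs infinitely
    often.\<close>
  then obtain m where m: "m \<in> {1..M}" "\<exists>\<^sub>F n in sequentially. Q n m"
    using frequently_bex_finite[of "{1..M}"] by blast
  have "(\<lambda>n. pi / \<kappa> * exp (- \<epsilon> * real n)) \<longlonglongrightarrow> 0"
  proof -
    have "(\<lambda>n. pi / \<kappa> * exp (- \<epsilon>) ^ n) \<longlonglongrightarrow> 0"
      using \<epsilon> by (intro tendsto_mult_right_zero LIMSEQ_realpow_zero) auto
    then show ?thesis by (simp add: mult.commute flip: exp_of_nat_mult)
  qed
  then have "in_attracting_basin (expmap a) 0"
    using expmap_recurrent_contraction_basin[OF assms(1) _ _ _ m(2)[unfolded Q_def]] m(1) \<epsilon> by simp
  then show False using nb by simp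
qed

end
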